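(* Let $L\in\mathbb Z_{\ge1}$, $\delta>0$, $C>0$. For all integers $N\ge1$ and all $z\in\mathbb C$ with $\mathrm{Re}(z)\le-\delta$ and $|z|\le C$, $$\frac{1}{(e^{z/N})_N}=\Big(\frac{-z}{2\pi N(1-e^{z})}\Big)^{1/2}\exp\Big(N\,p(z)+\sum_{\ell=1}^{L-1}\frac{f_\ell(z)}{N^\ell}+O(N^{-L})\Big),$$ with the principal square root and an implied constant depending only on $L,\delta,C$.
   Context: $(q)_N:=(1-q)(1-q^2)\cdots(1-q^N)$. Polylogarithms: $\mathrm{Li}_s(w)=\sum_{n\ge1}w^n/n^s$ for $|w|<1$ (and $|w|\le 1$ when $s=2$). $p(z):=\dfrac{\mathrm{Li}_2(e^{z})-\mathrm{Li}_2(1)}{z}$ (with $\mathrm{Li}_2(1)=\pi^2/6$), and for $\ell\ge1$, $f_\ell(z):=\delta_{1,\ell}\dfrac{z}{24}+\dfrac{B_{\ell+1}}{(\ell+1)!}z^{\ell}\,\mathrm{Li}_{1-\ell}(e^{z})$, where $B_n$ are the Bernoulli numbers ($z/(e^z-1)=\sum B_nz^n/n!$) and $\delta_{i,j}$ is the Kronecker delta. *)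

theory Defs
  imports "HOL-Analysis.Analysis" "HOL-Computational_Algebra.Formal_Power_Series"
begin

definition qpoch :: "complex \<Rightarrow> nat \<Rightarrow> complex" where
  "qpoch q N = (\<Prod>k=1..N. 1 - q ^ k)"

definition polylog :: "int \<Rightarrow> complex \<Rightarrow> complex" where
  "polylog s w = (\<Sum>n. w ^ Suc n / (of_nat (Suc n)) powi s)"

definition bernoulli_num :: "nat \<Rightarrow> real" where
  "bernoulli_num n = fact n * fps_nth ((fps_X :: real fps) / (fps_exp 1 - 1)) n"

definition pfun :: "complex \<Rightarrow> complex" where
  "pfun z = (polylog 2 (exp z) - of_real (pi\<^sup>2 / 6)) / z"

definition ffun :: "nat \<Rightarrow> complex \<Rightarrow> complex" where
  "ffun l z = (if l = 1 then z / 24 else 0)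
     + of_real (bernoulli_num (l + 1) / fact (l + 1)) * z ^ l * polylog (1 - int l) (exp z)"

end

theory Submission
  imports Defs "HOL-Complex_Analysis.Complex_Analysis" "HOL-Real_Asymp.Real_Asymp"
begin

text \<open>With \<open>h = z / N\<close> one has \<open>1 - exp (k h) = (- k h) g (k h)\<close> for \<open>g w = (exp w - 1) / w\<close>, hence
  \<open>(exp h)\<^sub>N = N! (- h)\<^sup>N \<Prod>k=1..N. g (k h)\<close>. The function \<open>Ln g\<close> is holomorphic near the segment
  from \<open>0\<close> to \<open>z\<close>, so Euler--Maclaurin summation applies to \<open>\<Sum>k. Ln (g (k h))\<close> with an error uniform
  on a compact sector, and the Stirling series accounts for \<open>N!\<close>. On the left half-plane
  \<open>Ln (g w) = Ln (1 - exp w) - Ln (- w)\<close>: the first part contributes the polylogarithms at \<open>z\<close>,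
  the second cancels the Stirling series. At the endpoint \<open>0\<close> only the first derivative survives,
  since \<open>Ln (g w) - w / 2\<close> is even and the odd Bernoulli numbers vanish; it gives \<open>z / 24\<close>.\<close>

subsection \<open>Bernoulli numbers and Euler--Maclaurin summation\<close>

text \<open>The quotients B_n / n!, the form in which Bernoulli numbers enter both Euler--Maclaurin
  summation and \<open>ffun\<close>.\<close>

definition bern_coeff :: "nat \<Rightarrow> real" where
  "bern_coeff n = bernoulli_num n / fact n"

lemma bern_coeff_altdef: "bern_coeff n = fps_nth (fps_X / (fps_exp 1 - 1)) n"
  by (simp add: bern_coeff_def bernoulli_num_def)

text \<open>Division of formal power series is total, so exactness must be shown:
  \<open>fps_exp 1 - 1\<close> has subdegree at most 1 and therefore divides
  \<open>fps_X\<close>.\<close>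

lemma bernoulli_fps_mult: "(fps_X / (fps_exp 1 - 1)) * (fps_exp 1 - 1) = (fps_X :: real fps)"
proof -
  have nz: "fps_nth (fps_exp 1 - 1 :: real fps) 1 \<noteq> 0" by simp
  hence "fps_exp 1 - 1 \<noteq> (0 :: real fps)" by (metis fps_zero_nth)
  moreover have "subdegree (fps_exp 1 - 1 :: real fps) \<le> 1"
    using nz by (rule subdegree_leI)
  ultimately have "(fps_exp 1 - 1 :: real fps) dvd fps_X"
    by (simp add: fps_dvd_iff)
  thus ?thesis by (rule dvd_div_mult_self)
qed

text \<open>Compare coefficients of X^m in \<open>bernoulli_fps_mult\<close>. The term
  \<open>j = m\<close> drops out because \<open>fps_exp 1 - 1\<close> has no constant term.\<close>

lemma bern_coeff_convolution:
  "(\<Sum>j<m. bern_coeff j / fact (m - j)) = (if m = 1 then 1 else 0)"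
proof -
  have "(if m = 1 then 1 else 0 :: real) = fps_nth fps_X m" by simp
  also have "\<dots> = fps_nth ((fps_X / (fps_exp 1 - 1)) * (fps_exp 1 - 1)) m"
    by (simp only: bernoulli_fps_mult)
  also have "\<dots> = (\<Sum>j=0..m. bern_coeff j * fps_nth (fps_exp 1 - 1) (m - j))"
    by (simp only: fps_mult_nth bern_coeff_altdef)
  also have "\<dots> = (\<Sum>j<m. bern_coeff j * fps_nth (fps_exp 1 - 1) (m - j))"
    by (rule sum.mono_neutral_right) auto
  also have "\<dots> = (\<Sum>j<m. bern_coeff j / fact (m - j))"
    by (intro sum.cong refl) auto
  finally show ?thesis by simp
qed

lemma bern_coeff_0: "bern_coeff 0 = 1"
  using bern_coeff_convolution[of 1] by simp

lemma bern_coeff_1: "bern_coeff 1 = - 1 / 2"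
  using bern_coeff_convolution[of 2] by (simp add: numeral_2_eq_2 bern_coeff_0 fact_reduce)

lemma bern_coeff_2: "bern_coeff 2 = 1 / 12"
  using bern_coeff_convolution[of 3] bern_coeff_1
  by (simp add: numeral_3_eq_3 numeral_2_eq_2 bern_coeff_0 fact_reduce)

text \<open>The generating series T satisfies T(-X) = T(X) + X, as multiplication by
  \<open>fps_exp 1 - 1\<close> shows. Beyond X^1, each odd coefficient thus equals its own
  negative.\<close>

lemma bern_coeff_odd:
  assumes "odd n" "n \<ge> 3"
  shows "bern_coeff n = 0"
proof -
  define T :: "real fps" where "T = fps_X / (fps_exp 1 - 1)"
  define U where "U = fps_compose T (- fps_X)"
  have T: "T * (fps_exp 1 - 1) = fps_X" unfolding T_def by (rule bernoulli_fps_mult)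
  have ex: "fps_compose (fps_exp 1) (- fps_X) = (fps_exp (-1) :: real fps)"
    by (auto simp: fps_compose_uminus' fps_eq_iff)
  have "fps_compose (T * (fps_exp 1 - 1)) (- fps_X) = U * (fps_exp (-1) - 1)"
    unfolding U_def by (simp add: fps_compose_mult_distrib fps_compose_sub_distrib ex)
  hence U: "U * (fps_exp (-1) - 1) = - fps_X" by (simp add: T)
  have ee: "fps_exp (-1) * fps_exp 1 = (1 :: real fps)"
    by (simp flip: fps_exp_add_mult)
  have "U * (fps_exp 1 - 1) = - (U * (fps_exp (-1) - 1)) * fps_exp 1"
    using ee by (simp add: algebra_simps)
  also have "\<dots> = fps_X * fps_exp 1" by (simp add: U)
  also have "\<dots> = (T + fps_X) * (fps_exp 1 - 1)"
    by (simp add: algebra_simps T[symmetric])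
  finally have "U * (fps_exp 1 - 1) = (T + fps_X) * (fps_exp 1 - 1)" .
  moreover have "fps_nth (fps_exp 1 - 1 :: real fps) 1 \<noteq> 0" by simp
  hence "fps_exp 1 - 1 \<noteq> (0 :: real fps)" by (metis fps_zero_nth)
  ultimately have "U = T + fps_X" by simp
  hence "fps_nth U n = fps_nth T n" using assms by simp
  moreover have "fps_nth U n = - fps_nth T n"
    using assms by (simp add: U_def fps_compose_uminus')
  ultimately show ?thesis by (simp add: bern_coeff_altdef T_def)
qed

section \<open>Euler--Maclaurin summation with a complex step\<close>

lemma divide_le_self_of_one_le: "0 \<le> a \<Longrightarrow> 1 \<le> b \<Longrightarrow> a / b \<le> (a :: real)"
  using mult_left_mono[of 1 b a] by (simp add: divide_le_eq)

text \<open>One step of Euler--Maclaurin summation: Taylor expansion of every term and the defining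
  recurrence of the Bernoulli numbers make the operator
  \<open>\<Sum>j\<le>M. B\<^sub>j / j! h\<^sup>j D\<^sup>j\<close> invert the forward difference up to order \<open>h\<^sup>M\<close>.\<close>

lemma euler_maclaurin_step:
  fixes F :: "nat \<Rightarrow> complex \<Rightarrow> complex" and h :: complex
  assumes S: "convex S" and M: "M \<ge> 1"
    and F: "\<And>j u. u \<in> S \<Longrightarrow> j \<le> M \<Longrightarrow> (F j has_field_derivative F (Suc j) u) (at u within S)"
    and B: "\<And>u. u \<in> S \<Longrightarrow> cmod (F (Suc M) u) \<le> B"
    and x: "x \<in> S" and xh: "x + h \<in> S"
  shows "cmod ((\<Sum>j\<le>M. of_real (bern_coeff j) * h ^ j * (F j (x + h) - F j x)) - h * F 1 x)
           \<le> (\<Sum>j\<le>M. \<bar>bern_coeff j\<bar>) * B * cmod h ^ Suc M"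
proof -
  have B0: "B \<ge> 0" using B[OF x] norm_ge_zero order_trans by blast
  \<comment> \<open>The Taylor order \<open>M - j\<close> decreases with j, so that every
    \<open>h ^ j * R j\<close> has the same order \<open>h ^ Suc M\<close>.\<close>
  define R where "R j = F j (x + h) - (\<Sum>i\<le>M-j. F (i + j) x * h ^ i / fact i)" for j
  have R: "cmod (R j) \<le> B * cmod h ^ (Suc M - j)" if "j \<le> M" for j
  proof -
    have "cmod (F (0 + j) (x + h) - (\<Sum>i\<le>M-j. F (i + j) x * ((x + h) - x) ^ i / fact i))
            \<le> B * cmod ((x + h) - x) ^ Suc (M - j) / fact (M - j)"
      using that x xh by (intro complex_Taylor[OF S, where f = "\<lambda>i. F (i + j)"]) (auto intro: F B)
    also have "\<dots> \<le> B * cmod ((x + h) - x) ^ Suc (M - j)"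
      using B0 fact_ge_1[of "M - j", where ?'a = real]
      by (intro divide_le_self_of_one_le) auto
    finally show ?thesis using that by (simp add: R_def Suc_diff_le)
  qed
  \<comment> \<open>Regrouping the Taylor polynomials by the total power \<open>m = i + j\<close>
    produces the Bernoulli recurrence as the coefficient of \<open>h ^ m * F m x\<close>; only
    \<open>m = 1\<close> survives.\<close>
  have "(\<Sum>j\<le>M. of_real (bern_coeff j) * h ^ j * (\<Sum>i=1..M-j. F (i + j) x * h ^ i / fact i))
      = (\<Sum>j\<le>M. \<Sum>m=j+1..M. of_real (bern_coeff j) * h ^ m * F m x / fact (m - j))"
  proof (rule sum.cong[OF refl])
    fix j assume "j \<in> {..M}"
    have "(\<Sum>m=j+1..M. of_real (bern_coeff j) * h ^ m * F m x / fact (m - j)) =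
          (\<Sum>i=1..M-j. of_real (bern_coeff j) * h ^ (i + j) * F (i + j) x / fact i)"
      by (rule sum.reindex_bij_witness[of _ "\<lambda>i. i + j" "\<lambda>m. m - j"]) auto
    thus "of_real (bern_coeff j) * h ^ j * (\<Sum>i=1..M-j. F (i + j) x * h ^ i / fact i) =
          (\<Sum>m=j+1..M. of_real (bern_coeff j) * h ^ m * F m x / fact (m - j))"
      by (simp add: sum_distrib_left power_add mult_ac)
  qed
  also have "\<dots> = (\<Sum>m\<le>M. \<Sum>j<m. of_real (bern_coeff j) * h ^ m * F m x / fact (m - j))"
    by (simp add: sum.Sigma)
       (rule sum.reindex_bij_witness[of _ "\<lambda>(a,b). (b,a)" "\<lambda>(a,b). (b,a)"], auto)
  also have "\<dots> = (\<Sum>m\<le>M. h ^ m * F m x * of_real (\<Sum>j<m. bern_coeff j / fact (m - j)))"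
    by (intro sum.cong refl) (simp add: sum_distrib_left mult_ac)
  also have "\<dots> = (\<Sum>m\<le>M. if m = 1 then h * F 1 x else 0)"
    unfolding bern_coeff_convolution by (intro sum.cong refl) auto
  also have "\<dots> = h * F 1 x" using M by simp
  finally have main: "(\<Sum>j\<le>M. of_real (bern_coeff j) * h ^ j * (\<Sum>i=1..M-j. F (i + j) x * h ^ i / fact i))
      = h * F 1 x" .
  have split: "F j (x + h) - F j x = (\<Sum>i=1..M-j. F (i + j) x * h ^ i / fact i) + R j" for j
  proof -
    have "{..M-j} = insert 0 {1..M-j}" by auto
    thus ?thesis by (simp add: R_def)
  qed
  have "(\<Sum>j\<le>M. of_real (bern_coeff j) * h ^ j * (F j (x + h) - F j x)) - h * F 1 x
      = (\<Sum>j\<le>M. of_real (bern_coeff j) * h ^ j * R j)"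
    unfolding split distrib_left sum.distrib main by simp
  also have "cmod \<dots> \<le> (\<Sum>j\<le>M. cmod (of_real (bern_coeff j) * h ^ j * R j))"
    by (rule norm_sum)
  also have "\<dots> \<le> (\<Sum>j\<le>M. \<bar>bern_coeff j\<bar> * B * cmod h ^ Suc M)"
  proof (rule sum_mono)
    fix j assume j: "j \<in> {..M}"
    have "cmod (of_real (bern_coeff j) * h ^ j * R j) = \<bar>bern_coeff j\<bar> * cmod h ^ j * cmod (R j)"
      by (simp add: norm_mult norm_power)
    also have "\<dots> \<le> \<bar>bern_coeff j\<bar> * cmod h ^ j * (B * cmod h ^ (Suc M - j))"
      using R j by (intro mult_left_mono) auto
    also have "\<dots> = \<bar>bern_coeff j\<bar> * B * (cmod h ^ j * cmod h ^ (Suc M - j))"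
      by simp
    also have "cmod h ^ j * cmod h ^ (Suc M - j) = cmod h ^ Suc M"
      using j by (subst power_add [symmetric]) auto
    finally show "cmod (of_real (bern_coeff j) * h ^ j * R j) \<le> \<bar>bern_coeff j\<bar> * B * cmod h ^ Suc M" .
  qed
  finally show ?thesis by (simp add: sum_distrib_right)
qed

text \<open>Sum the one-step estimate over the N points \<open>k * h\<close>: the differences of
  each \<open>F j\<close> telescope to the endpoints and the errors add up. Here \<open>F 1\<close>
  is the summand and \<open>F 0\<close> its primitive.\<close>

lemma euler_maclaurin_segment:
  fixes F :: "nat \<Rightarrow> complex \<Rightarrow> complex" and h :: complex
  assumes S: "convex S" and M: "M \<ge> 1"
    and F: "\<And>j u. u \<in> S \<Longrightarrow> j \<le> M \<Longrightarrow> (F j has_field_derivative F (Suc j) u) (at u within S)"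
    and B: "\<And>u. u \<in> S \<Longrightarrow> cmod (F (Suc M) u) \<le> B"
    and x: "\<And>k. k \<le> N \<Longrightarrow> of_nat k * h \<in> S"
  shows "cmod ((\<Sum>j\<le>M. of_real (bern_coeff j) * h ^ j * (F j (of_nat N * h) - F j 0))
             - h * (\<Sum>k<N. F 1 (of_nat k * h)))
           \<le> (\<Sum>j\<le>M. \<bar>bern_coeff j\<bar>) * B * real N * cmod h ^ Suc M"
proof -
  have tele: "(\<Sum>k<N. F j (of_nat k * h + h) - F j (of_nat k * h)) = F j (of_nat N * h) - F j 0" for j
    using sum_lessThan_telescope[of "\<lambda>k. F j (of_nat k * h)" N] by (simp add: algebra_simps)
  have "(\<Sum>j\<le>M. of_real (bern_coeff j) * h ^ j * (F j (of_nat N * h) - F j 0))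
             - h * (\<Sum>k<N. F 1 (of_nat k * h))
      = (\<Sum>k<N. (\<Sum>j\<le>M. of_real (bern_coeff j) * h ^ j * (F j (of_nat k * h + h) - F j (of_nat k * h)))
             - h * F 1 (of_nat k * h))"
    unfolding sum_subtractf sum_distrib_left
    by (subst sum.swap) (simp add: tele flip: sum_distrib_left)
  also have "cmod \<dots> \<le> (\<Sum>k<N. (\<Sum>j\<le>M. \<bar>bern_coeff j\<bar>) * B * cmod h ^ Suc M)"
  proof (rule sum_norm_le)
    fix k assume "k \<in> {..<N}"
    hence "of_nat k * h \<in> S" "of_nat k * h + h \<in> S"
      using x[of k] x[of "Suc k"] by (auto simp: algebra_simps)
    thus "cmod ((\<Sum>j\<le>M. of_real (bern_coeff j) * h ^ j * (F j (of_nat k * h + h) - F j (of_nat k * h)))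
             - h * F 1 (of_nat k * h)) \<le> (\<Sum>j\<le>M. \<bar>bern_coeff j\<bar>) * B * cmod h ^ Suc M"
      by (intro euler_maclaurin_step[OF S M F B]) auto
  qed
  finally show ?thesis by (simp add: mult_ac)
qed

subsection \<open>Polylogarithms\<close>

text \<open>Coefficients indexed by the exponent, with 0 at exponent 0, so that termwise
  differentiation of power series applies; \<open>polylog\<close> itself is indexed from
  \<open>Suc n\<close>.\<close>

definition polylog_coeff :: "int \<Rightarrow> nat \<Rightarrow> complex" where
  "polylog_coeff s n = (if n = 0 then 0 else 1 / of_nat n powi s)"

lemma polylog_coeff_bound: "cmod (polylog_coeff s n) \<le> real n ^ nat \<bar>s\<bar>"
proof (cases "n = 0")
  case False
  have "real n powi (- s) \<le> real n powi (int (nat \<bar>s\<bar>))"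
    using False by (intro power_int_increasing) auto
  also have "\<dots> = real n ^ nat \<bar>s\<bar>" by (rule power_int_of_nat)
  finally have "real n powi (- s) \<le> real n ^ nat \<bar>s\<bar>" .
  thus ?thesis
    using False by (simp add: polylog_coeff_def norm_divide norm_power_int power_int_minus field_simps)
qed (simp add: polylog_coeff_def)

lemma summable_poly_geometric:
  assumes "0 \<le> r" "r < (1::real)"
  shows "summable (\<lambda>n. real n ^ k * r ^ n)"
proof (rule summable_in_conv_radius)
  have "(\<lambda>n. (real n / real (Suc n)) ^ k) \<longlonglongrightarrow> 1 ^ k"
    by (intro tendsto_intros) real_asymp
  hence "conv_radius (\<lambda>n. real n ^ k) = ereal 1"
    by (intro conv_radius_ratio_limit[OF refl])
       (auto simp: power_divide intro!: eventually_mono[OF eventually_gt_at_top[of 0]])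
  thus "ereal (norm r) < conv_radius (\<lambda>n. real n ^ k)" using assms by simp
qed

lemma summable_polylog:
  assumes "cmod w < 1"
  shows "summable (\<lambda>n. polylog_coeff s n * w ^ n)"
proof (rule summable_comparison_test'[OF summable_poly_geometric[of "cmod w" "nat \<bar>s\<bar>"]])
  fix n :: nat
  show "norm (polylog_coeff s n * w ^ n) \<le> real n ^ nat \<bar>s\<bar> * cmod w ^ n"
    by (auto simp: norm_mult norm_power intro!: mult_right_mono polylog_coeff_bound)
qed (use assms in auto)

lemma polylog_altdef:
  assumes "cmod w < 1"
  shows "polylog s w = (\<Sum>n. polylog_coeff s n * w ^ n)"
proof -
  have "(\<Sum>n. polylog_coeff s (Suc n) * w ^ Suc n) = (\<Sum>n. polylog_coeff s n * w ^ n) - polylog_coeff s 0 * w ^ 0"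
    using suminf_minus_initial_segment[OF summable_polylog[OF assms], of s 1] by simp
  thus ?thesis by (simp add: polylog_def polylog_coeff_def)
qed

lemma has_field_derivative_polylog:
  assumes "cmod w < 1"
  shows "(polylog s has_field_derivative (\<Sum>n. diffs (polylog_coeff s) n * w ^ n)) (at w)"
proof -
  have "((\<lambda>w. \<Sum>n. polylog_coeff s n * w ^ n) has_field_derivative
           (\<Sum>n. diffs (polylog_coeff s) n * w ^ n)) (at w)"
    using assms by (intro termdiffs_strong'[of 1] summable_polylog)
  moreover have "\<forall>\<^sub>F w in nhds w. polylog s w = (\<Sum>n. polylog_coeff s n * w ^ n)"
    using eventually_nhds_in_open[of "ball 0 1" w] assms
    by (auto elim!: eventually_mono simp: polylog_altdef)
  ultimately show ?thesis by (subst DERIV_cong_ev[OF refl _ refl])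
qed

text \<open>The operator w d/dw multiplies the n-th coefficient by n, which lowers the order s by
  1.\<close>

lemma polylog_deriv_series:
  assumes "cmod w < 1"
  shows "w * (\<Sum>n. diffs (polylog_coeff s) n * w ^ n) = polylog (s - 1) w"
proof -
  have "summable (\<lambda>n. diffs (polylog_coeff s) n * w ^ n)"
    using assms by (intro termdiff_converges[of w 1] summable_polylog) auto
  hence "w * (\<Sum>n. diffs (polylog_coeff s) n * w ^ n) = (\<Sum>n. w * (diffs (polylog_coeff s) n * w ^ n))"
    by (rule suminf_mult[symmetric])
  also have "\<dots> = polylog (s - 1) w"
    unfolding polylog_def
    by (rule suminf_cong)
       (simp add: diffs_def polylog_coeff_def power_int_diff field_simps del: of_nat_Suc)
  finally show ?thesis .
qed

text \<open>Under the substitution of \<open>exp w\<close>, the operator of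
  \<open>polylog_deriv_series\<close> becomes the plain derivative.\<close>

lemma has_field_derivative_polylog_exp:
  assumes "Re w < 0"
  shows "((\<lambda>w. polylog s (exp w)) has_field_derivative polylog (s - 1) (exp w)) (at w)"
proof -
  have *: "cmod (exp w) < 1" using assms by simp
  show ?thesis
    using DERIV_chain2[OF has_field_derivative_polylog[OF *] DERIV_exp]
    by (simp add: polylog_deriv_series[OF *, symmetric] mult.commute)
qed

lemma polylog_1:
  assumes "cmod w < 1"
  shows "polylog 1 w = - Ln (1 - w)"
proof -
  have "(\<lambda>n. - (w ^ n) / of_nat n) sums ln (1 - w)"
    using Ln_series'[of "-w"] assms by simp
  hence "(\<lambda>n. - (- (w ^ n) / of_nat n)) sums - ln (1 - w)" by (rule sums_minus)
  moreover have "(\<lambda>n. - (- (w ^ n) / of_nat n)) = (\<lambda>n. polylog_coeff 1 n * w ^ n)"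
    by (auto simp: polylog_coeff_def)
  ultimately show ?thesis
    by (simp add: polylog_altdef[OF assms] sums_iff)
qed

text \<open>Continuity up to the boundary point 1 is what later fixes a constant of integration. The
  series converges uniformly by comparison with the inverse squares.\<close>

lemma continuous_on_polylog_2: "continuous_on (cball 0 1) (polylog 2)"
proof -
  have "uniform_limit (cball 0 1) (\<lambda>n (w::complex). \<Sum>i<n. w ^ Suc i / of_nat (Suc i) powi 2)
          (polylog 2) sequentially"
    unfolding polylog_def
  proof (rule Weierstrass_m_test)
    show "summable (\<lambda>n. 1 / (real n + 1)\<^sup>2)" using inverse_squares_sums by (simp add: sums_iff add_ac)
    show "norm (w ^ Suc n / of_nat (Suc n) powi 2) \<le> 1 / (real n + 1)\<^sup>2"
      if "w \<in> cball 0 1" for n and w :: complex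
    proof -
      have "cmod w ^ Suc n \<le> 1" using that by (intro power_le_one) auto
      moreover have "norm (of_nat (Suc n) powi 2 :: complex) = (real n + 1)\<^sup>2"
        by (simp only: norm_power_int norm_of_nat) simp
      ultimately show ?thesis
        by (simp only: norm_divide norm_power) (intro divide_right_mono, auto)
    qed
  qed
  thus ?thesis
    by (rule uniform_limit_theorem[rotated]) (auto intro!: always_eventually continuous_intros simp del: of_nat_Suc)
qed

lemma polylog_2_1: "polylog 2 1 = of_real (pi\<^sup>2 / 6)"
proof -
  have "(\<lambda>n. complex_of_real (1 / (real n + 1)\<^sup>2)) sums of_real (pi\<^sup>2 / 6)"
    using inverse_squares_sums by (intro sums_of_real) (simp add: add_ac)
  thus ?thesis by (simp add: polylog_def sums_iff add_ac)
qed

subsection \<open>Stirling series\<close>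

text \<open>Increments of order \<open>n ^ -(p + 1)\<close> are summable with tails of order
  \<open>n ^ -p\<close>; completeness supplies the limit.\<close>

lemma tail_bound_of_increments:
  fixes r :: "nat \<Rightarrow> 'a :: banach"
  assumes p: "p \<ge> 1" and K: "K \<ge> 0"
    and step: "\<And>n. n \<ge> 1 \<Longrightarrow> norm (r (Suc n) - r n) \<le> K / real n ^ Suc p"
  shows "\<exists>c. r \<longlonglongrightarrow> c \<and> (\<forall>n\<ge>1. norm (r n - c) \<le> 2 * K / real n ^ p)"
proof -
  \<comment> \<open>The telescoping form makes the induction on m close. The factor n^(1-p) is
    pulled out using \<open>m \<ge> n\<close>.\<close>
  have *: "norm (r m - r n) \<le> 2 * K * real n / real n ^ p * (1 / real n - 1 / real m)"
    if "n \<ge> 1" "m \<ge> n" for n m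
    using \<open>m \<ge> n\<close>
  proof (induction m rule: dec_induct)
    case (step m)
    have m: "real m \<ge> 1" "real n \<ge> 1" "real n \<le> real m" using step that by auto
    have "real m ^ 2 * real n ^ p \<le> real m ^ 2 * (real n * real m ^ (p - 1))"
      using p m by (cases p) (auto intro!: mult_left_mono power_mono)
    also have "\<dots> = real m ^ Suc p * real n"
      using p by (cases p) (auto simp: power2_eq_square)
    finally have A: "K / real m ^ Suc p \<le> K * real n / real n ^ p * (1 / real m ^ 2)"
      using K m by (simp add: field_simps) (metis mult.commute mult_left_mono mult.assoc)
    have "real m * 1 \<le> real m * real m" using m by (intro mult_left_mono) auto
    moreover have "1 / real m - 1 / real (Suc m) = 1 / (real m * real (Suc m))"
      using m by (simp add: field_simps)
    moreover have "real m + real m * real m > 0" using m by (intro add_pos_pos mult_pos_pos) auto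
    \<comment> \<open>The factor 2 comes from \<open>m + 1 \<le> 2 * m\<close>.\<close>
    ultimately have B: "1 / real m ^ 2 \<le> 2 * (1 / real m - 1 / real (Suc m))"
      using m by (simp add: divide_simps power2_eq_square algebra_simps)
    have "norm (r (Suc m) - r m) \<le> K / real m ^ Suc p"
      using m by (intro assms(3)) auto
    also note A
    also have "K * real n / real n ^ p * (1 / real m ^ 2)
        \<le> K * real n / real n ^ p * (2 * (1 / real m - 1 / real (Suc m)))"
      using K B by (intro mult_left_mono) auto
    finally have C: "norm (r (Suc m) - r m)
        \<le> 2 * K * real n / real n ^ p * (1 / real m - 1 / real (Suc m))"
      by (simp add: mult_ac)
    have "norm (r (Suc m) - r n) \<le> norm (r (Suc m) - r m) + norm (r m - r n)"
      using norm_triangle_ineq[of "r (Suc m) - r m" "r m - r n"] by simp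
    also have "\<dots> \<le> 2 * K * real n / real n ^ p * (1 / real m - 1 / real (Suc m))
         + 2 * K * real n / real n ^ p * (1 / real n - 1 / real m)"
      using C step.IH by (rule add_mono)
    also have "\<dots> = 2 * K * real n / real n ^ p * (1 / real n - 1 / real (Suc m))"
      by (simp only: ring_distribs)
    finally show ?case .
  qed simp
  have bd: "norm (r m - r n) \<le> 2 * K / real n ^ p" if "n \<ge> 1" "m \<ge> n" for n m
  proof -
    have "norm (r m - r n) \<le> 2 * K * real n / real n ^ p * (1 / real n - 1 / real m)"
      using that by (rule *)
    also have "\<dots> \<le> 2 * K * real n / real n ^ p * (1 / real n)"
      using K that by (intro mult_left_mono) auto
    finally show ?thesis using that by simp
  qed
  have "Cauchy r"
  proof (rule CauchyI')
    fix e :: real assume e: "e > 0"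
    have "(\<lambda>n. 2 * K / real n ^ p) \<longlonglongrightarrow> 0"
      using p by real_asymp
    hence "\<forall>\<^sub>F n in sequentially. 2 * K / real n ^ p < e"
      using e by (rule order_tendstoD)
    hence "\<forall>\<^sub>F n in sequentially. n \<ge> 1 \<and> 2 * K / real n ^ p < e"
      using eventually_ge_at_top[of 1] by eventually_elim auto
    then obtain n0 where n0: "\<And>m. m \<ge> n0 \<Longrightarrow> m \<ge> 1 \<and> 2 * K / real m ^ p < e"
      unfolding eventually_at_top_linorder by blast
    show "\<exists>M. \<forall>m\<ge>M. \<forall>n>m. dist (r m) (r n) < e"
    proof (intro exI[of _ n0] allI impI)
      fix m n assume "m \<ge> n0" "n > m"
      thus "dist (r m) (r n) < e"
        using bd[of m n] n0[of m] by (auto simp: norm_minus_commute dist_norm)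
    qed
  qed
  then obtain c where c: "r \<longlonglongrightarrow> c"
    using Cauchy_convergent_iff convergent_def by blast
  have "norm (r n - c) \<le> 2 * K / real n ^ p" if "n \<ge> 1" for n
  proof -
    have "(\<lambda>m. norm (r m - r n)) \<longlonglongrightarrow> norm (c - r n)"
      by (intro tendsto_intros c)
    moreover have "\<forall>\<^sub>F m in sequentially. norm (r m - r n) \<le> 2 * K / real n ^ p"
      using bd that by (auto intro!: eventually_sequentiallyI[of n])
    ultimately have "norm (c - r n) \<le> 2 * K / real n ^ p"
      by (rule tendsto_upperbound) auto
    thus ?thesis by (simp add: norm_minus_commute)
  qed
  with c show ?thesis by blast
qed

section \<open>Stirling's constant from the Wallis product\<close>

lemma wallis_prod_fact:
  "(\<Prod>k=1..n. (4*real k^2) / (4*real k^2 - 1)) = (2 ^ n * fact n) ^ 4 / (fact (2 * n) ^ 2 * (2 * real n + 1))"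
proof (induction n)
  case (Suc n)
  have f: "fact (2 * Suc n) = (2 * real n + 2) * ((2 * real n + 1) * fact (2 * n))"
    by (simp add: algebra_simps)
  have "4 * (real (Suc n))^2 - 1 = (2 * real n + 1) * (2 * real n + 3)"
    by (simp add: power2_eq_square algebra_simps)
  moreover have "2 * real n + 1 \<noteq> 0" "2 * real n + 3 \<noteq> 0" "real n + 1 \<noteq> 0" "2 * real n + 2 \<noteq> 0" by linarith+
  moreover have "2 * real n + 2 = 2 * (real n + 1)" "2 * real (Suc n) + 1 = 2 * real n + 3" by simp_all
  ultimately show ?case
    unfolding prod.cl_ivl_Suc Suc f
    by (simp add: fact_Suc power_mult_distrib divide_simps add_ac) (simp add: power2_eq_square power4_eq_xxxx algebra_simps)
qed auto

text \<open>If \<open>a n\<close> denotes the sequence, then \<open>4 * a n - 2 * a (2 * n)\<close>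
  is, up to elementary terms, the logarithm of the Wallis product. Hence 2 c - 2 ln 2 = ln (pi /
  2).\<close>

lemma stirling_constant:
  fixes c :: real
  assumes a: "(\<lambda>n. ln (fact n) - real n * ln (real n) + real n - ln (real n) / 2) \<longlonglongrightarrow> c"
  shows "c = ln (2 * pi) / 2"
proof -
  define a where "a n = ln (fact n) - real n * ln (real n) + real n - ln (real n) / 2" for n :: nat
  have "(\<lambda>n. a (2 * n)) \<longlonglongrightarrow> c"
    by (rule filterlim_compose[OF assms[folded a_def]]) real_asymp
  hence "(\<lambda>n. 4 * a n - 2 * a (2 * n) + (ln (real n) - ln 2 - ln (2 * real n + 1)))
      \<longlonglongrightarrow> 4 * c - 2 * c + (- 2 * ln 2)"
    by (intro tendsto_intros assms[folded a_def]) (auto, real_asymp)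
  moreover have "\<forall>\<^sub>F n in sequentially. 4 * a n - 2 * a (2 * n) + (ln (real n) - ln 2 - ln (2 * real n + 1))
      = ln (\<Prod>k=1..n. (4*real k^2) / (4*real k^2 - 1))"
    using eventually_gt_at_top[of 0]
  proof eventually_elim
    case (elim n)
    have "ln (\<Prod>k=1..n. (4*real k^2) / (4*real k^2 - 1))
        = 4 * (n * ln 2 + ln (fact n)) - (2 * ln (fact (2 * n)) + ln (2 * real n + 1))"
      unfolding wallis_prod_fact using elim
      by (simp add: ln_div ln_mult ln_realpow add_pos_pos)
    thus ?case using elim by (simp add: a_def ln_mult field_simps)
  qed
  ultimately have "(\<lambda>n. ln (\<Prod>k=1..n. (4*real k^2) / (4*real k^2 - 1))) \<longlonglongrightarrow> 4 * c - 2 * c + (- 2 * ln 2)"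
    by (rule Lim_transform_eventually)
  moreover have "(\<lambda>n. ln (\<Prod>k=1..n. (4*real k^2) / (4*real k^2 - 1))) \<longlonglongrightarrow> ln (pi / 2)"
    by (intro tendsto_ln wallis) auto
  ultimately have "4 * c - 2 * c + (- 2 * ln 2) = ln (pi / 2)"
    by (rule LIMSEQ_unique)
  thus ?thesis by (simp add: ln_div ln_mult)
qed

text \<open>The primitive u Ln u - u of \<open>Ln\<close> and its successive derivatives. Index 1 is
  the summand \<open>Ln\<close>, matching \<open>F 1\<close> in the Euler--Maclaurin lemmas.\<close>

fun xlnx_deriv :: "nat \<Rightarrow> complex \<Rightarrow> complex" where
  "xlnx_deriv 0 u = u * Ln u - u"
| "xlnx_deriv (Suc 0) u = Ln u"
| "xlnx_deriv (Suc (Suc j)) u = (-1) ^ j * fact j / u ^ Suc j"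

lemma has_field_derivative_xlnx_deriv:
  assumes "Re u > 0"
  shows "(xlnx_deriv j has_field_derivative xlnx_deriv (Suc j) u) (at u)"
proof -
  have u: "u \<notin> \<real>\<^sub>\<le>\<^sub>0" "u \<noteq> 0" using assms by (auto simp: complex_nonpos_Reals_iff)
  consider "j = 0" | "j = 1" | i where "j = Suc (Suc i)"
    by (metis One_nat_def not0_implies_Suc)
  thus ?thesis
  proof cases
    case 1
    have "((\<lambda>u. u * Ln u - u) has_field_derivative Ln u) (at u)"
      using u by (auto intro!: derivative_eq_intros)
    moreover have "xlnx_deriv 0 = (\<lambda>u. u * Ln u - u)" by auto
    ultimately show ?thesis using 1 by simp
  next
    case 2
    have "xlnx_deriv (Suc 0) = Ln" by auto
    thus ?thesis using u 2 by (auto intro!: derivative_eq_intros simp: divide_inverse)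
  next
    case 3
    have "((\<lambda>u. (-1) ^ i * fact i / u ^ Suc i) has_field_derivative
        (- ((-1) ^ i * fact i * (of_nat (Suc i) * u ^ i)) / (u ^ Suc i * u ^ Suc i))) (at u)"
      using u by (auto intro!: derivative_eq_intros simp: field_simps simp del: of_nat_Suc power_Suc)
    also have "(- ((-1) ^ i * fact i * (of_nat (Suc i) * u ^ i)) / (u ^ Suc i * u ^ Suc i)) =
        xlnx_deriv (Suc j) u"
      using u unfolding 3 by (simp add: field_simps)
    also have "(\<lambda>u. (-1) ^ i * fact i / u ^ Suc i) = xlnx_deriv j" using 3 by auto
    finally show ?thesis .
  qed
qed

lemma sum_atMost_split_2:
  fixes f :: "nat \<Rightarrow> 'a :: comm_monoid_add"
  assumes "L \<ge> 1"
  shows "sum f {..Suc L} = f 0 + (f 1 + sum f {2..Suc L})"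
proof -
  have "{..Suc L} = insert 0 (insert 1 {2..Suc L})" using assms by auto
  thus ?thesis by (simp del: sum.cl_ivl_Suc)
qed

text \<open>One Euler--Maclaurin step with \<open>h = 1\<close> bounds the increments of the
  remainder by a multiple of \<open>n ^ -M\<close>, so the remainder converges at rate
  \<open>n ^ -(M - 1)\<close>. Subtracting \<open>ln n\<close> from \<open>ln n!\<close> leaves the
  sum of \<open>ln k\<close> over k below n.\<close>

lemma stirling_expansion:
  assumes M: "M \<ge> 2"
  shows "\<exists>K. \<forall>n\<ge>1. cmod (of_real (ln (fact n)) - of_real (ln (real n)) - of_real (ln (2 * pi) / 2)
            - (\<Sum>j\<le>M. of_real (bern_coeff j) * xlnx_deriv j (of_nat n))) \<le> K / real n ^ (M - 1)"
proof -
  define A where "A n = (\<Sum>j\<le>M. of_real (bern_coeff j) * xlnx_deriv j (of_nat n))" for n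
  define r where "r n = of_real (ln (fact n)) - of_real (ln (real n)) - A n" for n
  define K where "K = (\<Sum>j\<le>M. \<bar>bern_coeff j\<bar>) * fact (M - 1)"
  obtain i where i: "M = Suc (Suc i)" using M by (metis Suc_le_D numeral_2_eq_2 Suc_le_mono)
  have "\<exists>c. r \<longlonglongrightarrow> c \<and> (\<forall>n\<ge>1. norm (r n - c) \<le> 2 * K / real n ^ (M - 1))"
  proof (rule tail_bound_of_increments)
    show "M - 1 \<ge> 1" using M by simp
    show "K \<ge> 0" unfolding K_def by (intro mult_nonneg_nonneg sum_nonneg) auto
    fix n :: nat assume n: "n \<ge> 1"
    \<comment> \<open>This half-plane is convex, contains n and n + 1, and has
      \<open>cmod u \<ge> n\<close> throughout, which controls the derivative of order
      \<open>M + 1\<close>.\<close>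
    let ?S = "{u. Re u \<ge> real n}"
    have "cmod ((\<Sum>j\<le>M. of_real (bern_coeff j) * 1 ^ j * (xlnx_deriv j (of_nat n + 1) - xlnx_deriv j (of_nat n)))
            - 1 * xlnx_deriv 1 (of_nat n))
           \<le> (\<Sum>j\<le>M. \<bar>bern_coeff j\<bar>) * (fact (M - 1) / real n ^ M) * cmod 1 ^ Suc M"
    proof (rule euler_maclaurin_step)
      show "convex ?S" by (rule convex_halfspace_Re_ge)
      show "M \<ge> 1" using M by simp
      show "(xlnx_deriv j has_field_derivative xlnx_deriv (Suc j) u) (at u within ?S)"
        if "u \<in> ?S" "j \<le> M" for u j
        using that n by (intro has_field_derivative_at_within[OF has_field_derivative_xlnx_deriv]) auto
      show "cmod (xlnx_deriv (Suc M) u) \<le> fact (M - 1) / real n ^ M" if "u \<in> ?S" for u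
      proof -
        have "real n \<le> cmod u" using that complex_Re_le_cmod[of u] by simp
        hence "real n ^ M \<le> cmod u ^ M" by (intro power_mono) auto
        hence "fact (M - 1) / cmod u ^ M \<le> fact (M - 1) / real n ^ M"
          using n by (intro frac_le) auto
        thus ?thesis by (simp add: i norm_divide norm_mult norm_power del: fact_Suc)
      qed
    qed auto
    also have "(\<Sum>j\<le>M. of_real (bern_coeff j) * 1 ^ j * (xlnx_deriv j (of_nat n + 1) - xlnx_deriv j (of_nat n)))
            - 1 * xlnx_deriv 1 (of_nat n) = - (r (Suc n) - r n)"
    proof -
      have "of_real (ln (fact (Suc n))) - of_real (ln (real (Suc n))) = complex_of_real (ln (fact n))"
        by (simp add: ln_mult flip: of_real_diff)
      moreover have "Ln (of_nat n) = of_real (ln (real n))"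
        using Ln_of_real[of "real n"] n by simp
      ultimately show ?thesis
        unfolding r_def A_def by (simp add: algebra_simps sum_subtractf)
    qed
    finally show "cmod (r (Suc n) - r n) \<le> K / real n ^ Suc (M - 1)"
      using M by (simp add: K_def norm_minus_commute)
  qed
  then obtain c where c: "r \<longlonglongrightarrow> c" "\<And>n. n \<ge> 1 \<Longrightarrow> norm (r n - c) \<le> 2 * K / real n ^ (M - 1)"
    by blast
  \<comment> \<open>The terms with \<open>j \<ge> 2\<close> vanish at infinity, so the limit of r is
    that of the classical sequence \<open>a\<close>.\<close>
  define t where "t n = (\<Sum>j\<in>{2..M}. bern_coeff j * ((-1) ^ (j - 2) * fact (j - 2)) / real n ^ (j - 1))" for n
  have t: "t \<longlonglongrightarrow> 0"
    unfolding t_def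
  proof (rule tendsto_null_sum)
    fix j assume "j \<in> {2..M}"
    hence "j - 1 > 0" by auto
    thus "(\<lambda>n. bern_coeff j * ((-1) ^ (j - 2) * fact (j - 2)) / real n ^ (j - 1)) \<longlonglongrightarrow> 0"
      by real_asymp
  qed
  define a where "a n = ln (fact n) - real n * ln (real n) + real n - ln (real n) / 2" for n :: nat
  have r: "r n = of_real (a n - t n)" if "n \<ge> 1" for n
  proof -
    have ln: "Ln (of_nat n) = of_real (ln (real n))"
      using Ln_of_real[of "real n"] that by simp
    have "{..M} = insert 0 (insert 1 {2..M})" using M by auto
    hence "A n = xlnx_deriv 0 (of_nat n) - 1 / 2 * xlnx_deriv 1 (of_nat n)
              + (\<Sum>j=2..M. of_real (bern_coeff j) * xlnx_deriv j (of_nat n))"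
      by (simp add: A_def bern_coeff_0 bern_coeff_1[simplified])
    also have "(\<Sum>j=2..M. of_real (bern_coeff j) * xlnx_deriv j (of_nat n)) = of_real (t n)"
      unfolding t_def of_real_sum
    proof (rule sum.cong[OF refl])
      fix j assume "j \<in> {2..M}"
      then obtain k where "j = Suc (Suc k)" by (metis Suc_le_D numeral_2_eq_2 Suc_le_mono atLeastAtMost_iff)
      thus "of_real (bern_coeff j) * xlnx_deriv j (of_nat n) =
          complex_of_real (bern_coeff j * ((-1) ^ (j - 2) * fact (j - 2)) / real n ^ (j - 1))"
        by simp
    qed
    finally show ?thesis by (simp add: r_def a_def ln field_simps)
  qed
  have "(\<lambda>n. Re (r n) + t n) \<longlonglongrightarrow> Re c + 0"
    by (intro tendsto_intros c t)
  moreover have "\<forall>\<^sub>F n in sequentially. Re (r n) + t n = a n"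
    using eventually_ge_at_top[of 1] by eventually_elim (simp add: r)
  ultimately have "a \<longlonglongrightarrow> Re c" by (metis Lim_transform_eventually add_0_right)
  hence Rec: "Re c = ln (2 * pi) / 2"
    unfolding a_def by (rule stirling_constant)
  \<comment> \<open>The limit was obtained in the complex numbers; it is real because every
    \<open>r n\<close> with \<open>n \<ge> 1\<close> is.\<close>
  have "(\<lambda>n. Im (r n)) \<longlonglongrightarrow> Im c" by (intro tendsto_intros c)
  moreover have "\<forall>\<^sub>F n in sequentially. Im (r n) = 0"
    using eventually_ge_at_top[of 1] by eventually_elim (simp add: r)
  ultimately have "(\<lambda>_. 0) \<longlonglongrightarrow> Im c" by (rule Lim_transform_eventually)
  hence "Im c = 0" using LIMSEQ_unique by blast
  with Rec have "c = of_real (ln (2 * pi) / 2)" by (simp add: complex_eq_iff)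
  with c(2) show ?thesis
    by (intro exI[of _ "2 * K"]) (auto simp: r_def A_def algebra_simps)
qed

subsection \<open>The logarithm of (exp w - 1) / w\<close>

definition expm1_quot :: "complex \<Rightarrow> complex" where
  "expm1_quot w = (if w = 0 then 1 else (exp w - 1) / w)"

text \<open>The disc makes the endpoint 0 an interior point, so derivatives of all orders exist
  there. Its radius ensures \<open>3 * cmod w < 1\<close>.\<close>

definition log_dom :: "complex set" where
  "log_dom = {w. Re w < 0} \<union> ball 0 (1 / 3)"

definition log_quot :: "complex \<Rightarrow> complex" where
  "log_quot w = Ln (expm1_quot w)"

lemma holomorphic_expm1_quot: "expm1_quot holomorphic_on UNIV"
proof (rule no_isolated_singularity'[where K = "{0}"])
  have "(\<lambda>w. (exp w - 1) / w) holomorphic_on UNIV - {0}"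
    by (intro holomorphic_intros) auto
  thus "expm1_quot holomorphic_on UNIV - {0}"
    by (rule holomorphic_transform) (auto simp: expm1_quot_def)
  have "((\<lambda>w::complex. (exp w - exp 0) / (w - 0)) \<longlongrightarrow> exp 0) (at 0)"
    using DERIV_exp[of "0::complex"] unfolding has_field_derivative_iff by simp
  hence "((\<lambda>w::complex. (exp w - 1) / w) \<longlongrightarrow> 1) (at 0)" by simp
  hence "(expm1_quot \<longlongrightarrow> 1) (at 0)"
    by (rule Lim_transform_eventually) (auto simp: expm1_quot_def eventually_at_filter)
  thus "(expm1_quot \<longlongrightarrow> expm1_quot z) (at z within UNIV)" if "z \<in> {0}" for z
    using that by (simp add: expm1_quot_def)
qed auto

lemma Re_one_minus_exp_pos: "Re w < 0 \<Longrightarrow> Re (1 - exp w) > 0"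
  using complex_Re_le_cmod[of "exp w"] by (simp only: norm_exp_eq_Re) (simp add: order_le_less_trans)

text \<open>By Taylor's theorem exp w - 1 - w has modulus at most 3 |w|^2, so the quotient lies
  within 3 |w| < 1 of 1.\<close>

lemma Re_expm1_quot_pos:
  assumes "cmod w < 1 / 3"
  shows "Re (expm1_quot w) > 0"
proof (cases "w = 0")
  case False
  have "exp \<bar>Re w\<bar> \<le> exp (1 :: real)"
    using assms abs_Re_le_cmod[of w] by simp
  hence e: "exp \<bar>Re w\<bar> \<le> 3" using exp_le by linarith
  have "cmod (exp w - 1 - w) \<le> exp \<bar>Re w\<bar> * cmod w ^ 2"
    using Taylor_exp[of w 1] by (simp add: algebra_simps numeral_2_eq_2)
  also have "\<dots> \<le> 3 * cmod w ^ 2" using e by (intro mult_right_mono) auto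
  finally have "cmod (exp w - 1 - w) / cmod w \<le> 3 * cmod w"
    using False by (simp add: field_simps power2_eq_square)
  also have "\<dots> < 1" using assms by simp
  finally have "cmod (expm1_quot w - 1) < 1"
    using False by (simp add: expm1_quot_def diff_divide_distrib norm_divide[symmetric])
  thus ?thesis using abs_Re_le_cmod[of "expm1_quot w - 1"] by simp
qed (simp add: expm1_quot_def)

text \<open>In the left half-plane a value r \<le> 0 would mean 1 - exp w = - r w, where the left
  side has positive and the right side nonpositive real part. In the disc the real part of the
  quotient is positive.\<close>

lemma expm1_quot_nonpos_Reals:
  assumes "w \<in> log_dom"
  shows "expm1_quot w \<notin> \<real>\<^sub>\<le>\<^sub>0"
proof (cases "Re w < 0")
  case True
  show ?thesis
  proof
    assume "expm1_quot w \<in> \<real>\<^sub>\<le>\<^sub>0"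
    then obtain r where r: "expm1_quot w = of_real r" "r \<le> 0"
      by (auto elim!: nonpos_Reals_cases)
    have "1 - exp w = - of_real r * w"
      using True r(1) by (auto simp: expm1_quot_def field_simps split: if_splits)
    hence "Re (1 - exp w) = - r * Re w" by simp
    moreover have "- r * Re w \<le> 0" using r True by (simp add: mult_nonpos_nonpos)
    ultimately show False using Re_one_minus_exp_pos[OF True] by linarith
  qed
next
  case False
  hence "Re (expm1_quot w) > 0" using assms by (intro Re_expm1_quot_pos) (auto simp: log_dom_def)
  thus ?thesis by (auto simp: complex_nonpos_Reals_iff)
qed

lemma open_log_dom: "open log_dom"
  unfolding log_dom_def by (intro open_Un open_ball open_halfspace_Re_lt)

text \<open>The domain is not convex, but being starlike about 0 is enough for a primitive to
  exist.\<close>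

lemma starlike_log_dom: "starlike log_dom"
  unfolding starlike_def
proof (rule bexI[of _ 0], intro ballI subsetI)
  fix w u assume w: "w \<in> log_dom" and "u \<in> closed_segment 0 w"
  then obtain t where t: "0 \<le> t" "t \<le> 1" "u = of_real t * w"
    by (auto simp: in_segment scaleR_conv_of_real)
  have "cmod u \<le> cmod w" using t by (simp add: norm_mult mult_left_le_one_le)
  moreover have "Re u < 0" if "Re w < 0" "t \<noteq> 0"
    using t that by (simp add: mult_pos_neg)
  ultimately show "u \<in> log_dom"
    using w t by (cases "t = 0") (auto simp: log_dom_def)
qed (simp add: log_dom_def)

lemma holomorphic_log_quot: "log_quot holomorphic_on log_dom"
proof -
  have "(\<lambda>w. Ln (expm1_quot w)) holomorphic_on log_dom"
    using holomorphic_expm1_quot expm1_quot_nonpos_Reals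
    by (intro holomorphic_intros) (auto intro: holomorphic_on_subset)
  thus ?thesis by (simp add: log_quot_def[abs_def])
qed

text \<open>Both logarithms have imaginary part of modulus below pi / 2, so their difference stays
  in the principal strip.\<close>

lemma Ln_divide_right_half_plane:
  assumes "Re a > 0" "Re b > 0"
  shows "Ln (a / b) = Ln a - Ln b"
proof (rule Ln_unique)
  have "a \<noteq> 0" "b \<noteq> 0" using assms by auto
  thus "exp (Ln a - Ln b) = a / b" by (simp add: exp_diff)
qed (use Re_Ln_pos_lt_imp[OF assms(1)] Re_Ln_pos_lt_imp[OF assms(2)] in auto)

lemma log_quot_half_plane:
  assumes "Re w < 0"
  shows "log_quot w = Ln (1 - exp w) - Ln (- w)"
proof -
  have "expm1_quot w = (1 - exp w) / (- w)"
    using assms by (auto simp: expm1_quot_def field_simps)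
  thus ?thesis unfolding log_quot_def
    using Re_one_minus_exp_pos[OF assms] assms by (simp only:) (intro Ln_divide_right_half_plane, auto)
qed

text \<open>Exponentiated, this is g(-w) = exp(-w) g(w) for \<open>g = expm1_quot\<close>. The
  imaginary parts differ by less than pi + 1 < 2 pi, so the logarithms agree.\<close>

lemma log_quot_minus:
  assumes "cmod w < 1 / 3"
  shows "log_quot (- w) = log_quot w - w"
proof (rule exp_complex_eqI)
  have pos: "Re (expm1_quot w) > 0" "Re (expm1_quot (- w)) > 0"
    using assms by (auto intro!: Re_expm1_quot_pos)
  hence nz: "expm1_quot w \<noteq> 0" "expm1_quot (- w) \<noteq> 0" by auto
  have "exp (- w) * (exp w - 1) = 1 - exp (- w)"
    by (simp add: algebra_simps flip: exp_add)
  hence "expm1_quot (- w) = exp (- w) * expm1_quot w"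
    by (auto simp: expm1_quot_def field_simps)
  thus "exp (log_quot (- w)) = exp (log_quot w - w)"
    using nz by (simp add: log_quot_def exp_diff exp_minus field_simps)
  have "\<bar>Im w\<bar> < 1" using assms abs_Im_le_cmod[of w] by linarith
  thus "\<bar>Im (log_quot (- w)) - Im (log_quot w - w)\<bar> < 2 * pi"
    using Re_Ln_pos_lt_imp[OF pos(1)] Re_Ln_pos_lt_imp[OF pos(2)] pi_gt3
    unfolding log_quot_def by simp
qed

text \<open>Differentiate \<open>log_quot_minus\<close> k times at 0: for odd k the derivative D
  satisfies - D = D - [k = 1].\<close>

lemma odd_higher_deriv_log_quot_0:
  assumes "odd k"
  shows "(deriv ^^ k) log_quot 0 = (if k = 1 then 1 / 2 else 0)"
proof -
  let ?B = "ball (0::complex) (1/3)"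
  have hol: "log_quot holomorphic_on ?B"
    using holomorphic_log_quot by (rule holomorphic_on_subset) (auto simp: log_dom_def)
  have hol': "(\<lambda>w. log_quot (-1 * w)) holomorphic_on ?B"
  proof -
    have "(\<lambda>w. -1 * w) holomorphic_on ?B" by (intro holomorphic_intros)
    moreover have "(\<lambda>w. -1 * w) ` ?B \<subseteq> ?B" by auto
    ultimately show ?thesis using holomorphic_on_compose_gen[OF _ hol] by (auto simp: o_def)
  qed
  have "(-1) ^ k * (deriv ^^ k) log_quot (-1 * 0) = (deriv ^^ k) (\<lambda>w. log_quot (-1 * w)) 0"
    by (rule higher_deriv_compose_linear[OF hol, symmetric, of ?B]) auto
  also have "\<dots> = (deriv ^^ k) (\<lambda>w. log_quot w - w) 0"
    by (rule higher_deriv_transform_within_open[of _ ?B])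
       (use hol hol' in \<open>auto simp: log_quot_minus intro!: holomorphic_intros\<close>)
  also have "\<dots> = (deriv ^^ k) log_quot 0 - (deriv ^^ k) (\<lambda>w. w) 0"
    by (rule higher_deriv_diff[of _ ?B]) (use hol in \<open>auto intro!: holomorphic_intros\<close>)
  finally have "- (deriv ^^ k) log_quot 0 = (deriv ^^ k) log_quot 0 - (if k = 1 then 1 else 0)"
    using assms by (cases "k = 0") auto
  thus ?thesis by (auto simp: field_simps)
qed

section \<open>The primitive of \<open>log_quot\<close> and its derivatives\<close>

lemma log_quot_primitive_exists:
  "\<exists>G. G 0 = 0 \<and> (\<forall>w\<in>log_dom. (G has_field_derivative log_quot w) (at w))"
proof -
  obtain G where G: "\<forall>w\<in>log_dom. (G has_field_derivative log_quot w) (at w)"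
    using holomorphic_starlike_primitive[of log_dom log_quot "{}"] starlike_log_dom open_log_dom
      holomorphic_on_imp_continuous_on[OF holomorphic_log_quot]
      holomorphic_on_imp_differentiable_at[OF holomorphic_log_quot] by auto
  have "((\<lambda>w. G w - G 0) has_field_derivative log_quot w) (at w)" if "w \<in> log_dom" for w
    using G that by (auto intro!: derivative_eq_intros)
  thus ?thesis by (intro exI[of _ "\<lambda>w. G w - G 0"]) auto
qed

text \<open>The iterated derivatives of this function serve as the family \<open>F j\<close> in
  Euler--Maclaurin summation, with \<open>log_quot\<close> as \<open>F 1\<close>.\<close>

definition log_prim :: "complex \<Rightarrow> complex" where
  "log_prim = (SOME G. G 0 = 0 \<and> (\<forall>w\<in>log_dom. (G has_field_derivative log_quot w) (at w)))"

lemma log_prim_0: "log_prim 0 = 0"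
  and has_field_derivative_log_prim:
    "w \<in> log_dom \<Longrightarrow> (log_prim has_field_derivative log_quot w) (at w)"
  using someI_ex[OF log_quot_primitive_exists] by (auto simp: log_prim_def)

lemma holomorphic_log_prim: "log_prim holomorphic_on log_dom"
  using has_field_derivative_log_prim open_log_dom holomorphic_on_open by blast

lemma higher_deriv_log_prim_Suc:
  assumes "w \<in> log_dom"
  shows "(deriv ^^ Suc k) log_prim w = (deriv ^^ k) log_quot w"
  unfolding funpow_Suc_right o_def
  using assms holomorphic_log_prim holomorphic_log_quot open_log_dom
  by (intro higher_deriv_transform_within_open[of _ log_dom] holomorphic_deriv)
     (auto intro!: DERIV_imp_deriv has_field_derivative_log_prim)

lemma has_field_derivative_xlnx_deriv_uminus:
  assumes "Re w < 0"
  shows "((\<lambda>w. xlnx_deriv j (- w)) has_field_derivative - xlnx_deriv (Suc j) (- w)) (at w)"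
proof -
  have "((\<lambda>w. xlnx_deriv j (- w)) has_field_derivative xlnx_deriv (Suc j) (- w) * - 1) (at w)"
    using assms
    by (intro DERIV_chain2[where f = "xlnx_deriv j" and g = uminus] has_field_derivative_xlnx_deriv)
       (auto intro!: derivative_eq_intros)
  thus ?thesis by simp
qed

text \<open>By \<open>log_quot_half_plane\<close> both sides have the same derivative, so they
  differ by a constant, which is determined by the limit at 0.\<close>

lemma log_prim_half_plane:
  assumes "Re w < 0"
  shows "log_prim w = of_real (pi\<^sup>2 / 6) - polylog 2 (exp w) + xlnx_deriv 0 (- w)"
proof -
  let ?S = "{w. Re w < 0}"
  define H where "H w = log_prim w + polylog 2 (exp w) - xlnx_deriv 0 (- w)" for w
  have "(H has_field_derivative 0) (at w within ?S)" if "w \<in> ?S" for w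
  proof -
    have w: "Re w < 0" using that by simp
    hence "cmod (exp w) < 1" by simp
    hence Li: "polylog (2 - 1) (exp w) = - Ln (1 - exp w)" using polylog_1 by simp
    have Q: "((\<lambda>w. xlnx_deriv 0 (- w)) has_field_derivative - Ln (- w)) (at w)"
      using has_field_derivative_xlnx_deriv_uminus[OF w, of 0] by simp
    have "w \<in> log_dom" using w by (simp add: log_dom_def)
    from DERIV_diff[OF DERIV_add[OF has_field_derivative_log_prim[OF this]
           has_field_derivative_polylog_exp[OF w, of 2]] Q]
    have "(H has_field_derivative log_quot w + polylog (2 - 1) (exp w) - - Ln (- w)) (at w)"
      unfolding H_def[abs_def] .
    hence "(H has_field_derivative 0) (at w)"
      unfolding Li log_quot_half_plane[OF w] by simp
    thus ?thesis by (rule has_field_derivative_at_within)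
  qed
  then obtain c where c: "\<And>w. Re w < 0 \<Longrightarrow> H w = c"
    using has_field_derivative_zero_constant[of ?S H] convex_halfspace_Re_lt by auto
  \<comment> \<open>A sequence in the half-plane tending to its boundary point 0; there
    \<open>polylog 2 (exp w)\<close> is only known to be continuous, from inside, and u Ln u tends
    to 0.\<close>
  define x where "x n = complex_of_real (- 1 / real (Suc n))" for n
  have x: "x \<longlonglongrightarrow> 0"
  proof -
    have "(\<lambda>n. - 1 / real (Suc n)) \<longlonglongrightarrow> 0" by real_asymp
    from tendsto_of_real[OF this, where ?'a = complex] show ?thesis by (simp add: x_def[abs_def])
  qed
  have lim1: "(\<lambda>n. log_prim (x n)) \<longlonglongrightarrow> log_prim 0"
    by (rule isCont_tendsto_compose[OF _ x])
       (rule DERIV_isCont[OF has_field_derivative_log_prim], simp add: log_dom_def)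
  have lim2: "(\<lambda>n. polylog 2 (exp (x n))) \<longlonglongrightarrow> polylog 2 1"
  proof (rule continuous_on_tendsto_compose[OF continuous_on_polylog_2])
    show "(\<lambda>n. exp (x n)) \<longlonglongrightarrow> 1" using tendsto_exp[OF x] by simp
    show "\<forall>\<^sub>F n in sequentially. exp (x n) \<in> cball 0 1"
      by (intro always_eventually) (auto simp: x_def simp del: of_real_divide)
  qed auto
  have x3: "xlnx_deriv 0 (- x n) = of_real (1 / real (Suc n) * ln (1 / real (Suc n)) - 1 / real (Suc n))" for n
  proof -
    have "- x n = of_real (1 / real (Suc n))" by (simp add: x_def)
    moreover have "Ln (of_real (1 / real (Suc n))) = complex_of_real (ln (1 / real (Suc n)))"
      by (rule Ln_of_real) simp
    ultimately show ?thesis by simp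
  qed
  have "(\<lambda>n. 1 / real (Suc n) * ln (1 / real (Suc n)) - 1 / real (Suc n)) \<longlonglongrightarrow> 0"
    by real_asymp
  hence "(\<lambda>n. complex_of_real (1 / real (Suc n) * ln (1 / real (Suc n)) - 1 / real (Suc n))) \<longlonglongrightarrow> of_real 0"
    by (rule tendsto_of_real)
  hence lim3: "(\<lambda>n. xlnx_deriv 0 (- x n)) \<longlonglongrightarrow> 0" by (simp only: x3 of_real_0)
  have "(\<lambda>n. H (x n)) \<longlonglongrightarrow> log_prim 0 + polylog 2 1 - 0"
    unfolding H_def by (intro tendsto_intros lim1 lim2 lim3)
  moreover have "H (x n) = c" for n
    by (rule c) (simp add: x_def del: of_real_divide)
  ultimately have "c = log_prim 0 + polylog 2 1 - 0"
    by (simp add: LIMSEQ_const_iff)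
  thus ?thesis using c[OF assms] by (simp add: H_def log_prim_0 polylog_2_1 algebra_simps)
qed

text \<open>Each differentiation lowers the polylogarithm order by 1 and contributes a sign from the
  argument \<open>- w\<close>.\<close>

lemma higher_deriv_log_prim_half_plane:
  assumes "Re w < 0"
  shows "(deriv ^^ j) log_prim w = (if j = 0 then of_real (pi\<^sup>2 / 6) else 0)
           - polylog (2 - int j) (exp w) + (-1) ^ j * xlnx_deriv j (- w)"
  using assms
proof (induction j arbitrary: w)
  case 0
  thus ?case by (simp add: log_prim_half_plane)
next
  case (Suc j)
  let ?S = "{w. Re w < 0}"
  let ?g = "\<lambda>w. (if j = 0 then of_real (pi\<^sup>2 / 6) else 0)
              - polylog (2 - int j) (exp w) + (-1) ^ j * xlnx_deriv j (- w)"
  note Q = has_field_derivative_xlnx_deriv_uminus[OF Suc.prems, of j]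
  have "(?g has_field_derivative 0 - polylog (2 - int j - 1) (exp w) + (-1) ^ j * - xlnx_deriv (Suc j) (- w)) (at w)"
    by (intro DERIV_add DERIV_diff DERIV_const DERIV_cmult Q has_field_derivative_polylog_exp Suc.prems)
  hence "((deriv ^^ j) log_prim has_field_derivative
       0 - polylog (2 - int j - 1) (exp w) + (-1) ^ j * - xlnx_deriv (Suc j) (- w)) (at w)"
    by (rule has_field_derivative_transform_within_open[of _ _ _ ?S])
       (use Suc open_halfspace_Re_lt in auto)
  hence "deriv ((deriv ^^ j) log_prim) w =
       0 - polylog (2 - int j - 1) (exp w) + (-1) ^ j * - xlnx_deriv (Suc j) (- w)"
    by (rule DERIV_imp_deriv)
  moreover have "2 - int j - 1 = 2 - int (Suc j)" by simp
  ultimately show ?case by (simp only: funpow.simps o_def) simp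
qed

subsection \<open>The asymptotic expansion\<close>

text \<open>Each factor is exponentiated separately, so no branch of a logarithm of the whole
  product has to be tracked.\<close>

lemma qpoch_exp:
  assumes N: "N \<ge> 1" and z: "Re z < 0"
  defines "h \<equiv> z / of_nat N"
  shows "qpoch (exp h) N
           = exp (of_real (ln (fact N)) + of_nat N * Ln (- h) + (\<Sum>k=1..N. log_quot (of_nat k * h)))"
proof -
  have h: "h \<noteq> 0" using z N by (auto simp: h_def)
  have factor: "1 - exp h ^ k = of_nat k * (- h) * exp (log_quot (of_nat k * h))" if k: "k \<in> {1..N}" for k
  proof -
    have "Re (of_nat k * h) < 0"
      using z N k by (simp add: h_def Re_divide_of_nat mult_pos_neg divide_neg_pos)
    hence "expm1_quot (of_nat k * h) \<notin> \<real>\<^sub>\<le>\<^sub>0"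
      by (intro expm1_quot_nonpos_Reals) (simp add: log_dom_def)
    hence "exp (log_quot (of_nat k * h)) = expm1_quot (of_nat k * h)"
      unfolding log_quot_def by (intro exp_Ln) auto
    thus ?thesis using h k by (simp add: expm1_quot_def exp_of_nat_mult)
  qed
  have "qpoch (exp h) N = (\<Prod>k=1..N. of_nat k * (- h) * exp (log_quot (of_nat k * h)))"
    unfolding qpoch_def by (intro prod.cong refl factor)
  also have "\<dots> = fact N * (- h) ^ N * exp (\<Sum>k=1..N. log_quot (of_nat k * h))"
    unfolding prod.distrib by (simp add: exp_sum fact_prod)
  also have "(fact N :: complex) = exp (of_real (ln (fact N)))"
    by (subst exp_of_real) simp
  also have "(- h) ^ N = exp (of_nat N * Ln (- h))"
    using h by (simp add: exp_of_nat_mult)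
  finally show ?thesis by (simp add: exp_add)
qed

text \<open>With \<open>j = Suc l\<close> the order is \<open>2 - j\<close>, as in the j-th
  derivative of \<open>log_prim\<close>.\<close>

lemma ffun_altdef:
  "ffun l z = (if l = 1 then z / 24 else 0)
     + of_real (bern_coeff (Suc l)) * z ^ l * polylog (2 - int (Suc l)) (exp z)"
  by (simp add: ffun_def bern_coeff_def)

text \<open>For odd j the Bernoulli factor vanishes, for even \<open>j > 2\<close> the derivative
  does; \<open>j = 2\<close> leaves 1/12 times 1/2.\<close>

lemma bern_coeff_higher_deriv_log_prim_0:
  assumes "j \<ge> 2"
  shows "of_real (bern_coeff j) * (deriv ^^ j) log_prim 0 = (if j = 2 then 1 / 24 else 0)"
proof -
  obtain k where k: "j = Suc k" "k \<ge> 1" using assms by (cases j) auto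
  have F: "(deriv ^^ j) log_prim 0 = (deriv ^^ k) log_quot 0"
    unfolding k by (rule higher_deriv_log_prim_Suc) (simp add: log_dom_def)
  show ?thesis
  proof (cases "odd k")
    case True
    hence "(deriv ^^ j) log_prim 0 = (if j = 2 then 1 / 2 else 0)"
      using k unfolding F by (subst odd_higher_deriv_log_quot_0) auto
    thus ?thesis by (simp add: bern_coeff_2)
  next
    case False
    have "odd j" using False k by simp
    moreover have "j \<ge> 3" using False k by presburger
    ultimately show ?thesis using bern_coeff_odd[of j] by simp
  qed
qed

text \<open>The terms at the endpoint \<open>z\<close> that come from \<open>Ln (- w)\<close> are independent of \<open>z\<close>: they are the
  Stirling terms of \<open>ln N!\<close> with the opposite sign.\<close>

lemma euler_maclaurin_log_quot_terms:
  fixes z :: complex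
  assumes N: "N \<ge> 1" and z: "Re z < 0" and L: "L \<ge> 1"
  defines "h \<equiv> z / of_nat N"
  shows "(\<Sum>j\<le>Suc L. of_real (bern_coeff j) * h ^ j * ((deriv ^^ j) log_prim z - (deriv ^^ j) log_prim 0)) / h
         = - (of_nat N * pfun z) - of_nat N * Ln (- z) + of_nat N - log_quot z / 2
           - (\<Sum>l=1..L. ffun l z / of_nat N ^ l)
           - (\<Sum>j=2..Suc L. of_real (bern_coeff j) * xlnx_deriv j (of_nat N))"
proof -
  let ?F = "\<lambda>j. (deriv ^^ j) log_prim"
  let ?b = "\<lambda>j. complex_of_real (bern_coeff j)"
  have nz: "z \<noteq> 0" "h \<noteq> 0" using z N by (auto simp: h_def)
  have zd: "z \<in> log_dom" "0 \<in> log_dom" using z by (auto simp: log_dom_def)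
  have "(\<Sum>j\<le>Suc L. ?b j * h ^ j * (?F j z - ?F j 0)) / h
       = (?F 0 z - ?F 0 0) / h - (?F 1 z - ?F 1 0) / 2 + (\<Sum>j=2..Suc L. ?b j * h ^ j * (?F j z - ?F j 0)) / h"
    unfolding sum_atMost_split_2[OF L] using nz
    by (simp add: bern_coeff_0 bern_coeff_1[simplified] add_divide_distrib diff_divide_distrib
             del: sum.cl_ivl_Suc)
  also have "(?F 0 z - ?F 0 0) / h = - (of_nat N * pfun z) - of_nat N * Ln (- z) + of_nat N"
    using nz N z by (simp add: log_prim_half_plane log_prim_0 pfun_def h_def field_simps)
  \<comment> \<open>The value at 0 is \<open>Ln 1 = 0\<close>.\<close>
  also have "?F 1 z - ?F 1 0 = log_quot z"
    using higher_deriv_log_prim_Suc[OF zd(1), of 0] higher_deriv_log_prim_Suc[OF zd(2), of 0]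
    by (simp add: log_quot_def expm1_quot_def)
  also have "(\<Sum>j=2..Suc L. ?b j * h ^ j * (?F j z - ?F j 0)) / h
      = (\<Sum>j=2..Suc L. - (?b j * h ^ (j - 1) * polylog (2 - int j) (exp z))
            - ?b j * xlnx_deriv j (of_nat N) - (if j = 2 then h / 24 else 0))"
    unfolding sum_divide_distrib
  proof (rule sum.cong[OF refl])
    fix j assume "j \<in> {2..Suc L}"
    then obtain i where i: "j = Suc (Suc i)" by (metis Suc_le_D numeral_2_eq_2 Suc_le_mono atLeastAtMost_iff)
    have Fz: "?F j z = - polylog (2 - int j) (exp z) + (-1) ^ j * xlnx_deriv j (- z)"
      using higher_deriv_log_prim_half_plane[OF z, of j] i by simp
    \<comment> \<open>For \<open>j \<ge> 2\<close>, \<open>xlnx_deriv j\<close> is homogeneous of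
      degree \<open>1 - j\<close>; since \<open>h = z / N\<close>, the variable z cancels and only N
      remains.\<close>
    have X: "h ^ (j - 1) * ((-1) ^ j * xlnx_deriv j (- z)) = - xlnx_deriv j (of_nat N)"
    proof -
      have "(- z) ^ Suc i = (-1) ^ Suc i * z ^ Suc i" by (rule power_minus)
      thus ?thesis using nz N unfolding i h_def
        by (simp add: power_divide field_simps)
    qed
    have F0: "?b j * ?F j 0 = (if j = 2 then 1 / 24 else 0)"
      using i by (intro bern_coeff_higher_deriv_log_prim_0) auto
    have "?b j * h ^ j * (?F j z - ?F j 0) / h = ?b j * h ^ (j - 1) * (?F j z - ?F j 0)"
      using nz i by simp
    also have "\<dots> = - (?b j * h ^ (j - 1) * polylog (2 - int j) (exp z))
        + ?b j * (h ^ (j - 1) * ((-1) ^ j * xlnx_deriv j (- z))) - h ^ (j - 1) * (?b j * ?F j 0)"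
      unfolding Fz by (simp add: algebra_simps)
    also have "\<dots> = - (?b j * h ^ (j - 1) * polylog (2 - int j) (exp z))
            - ?b j * xlnx_deriv j (of_nat N) - (if j = 2 then h / 24 else 0)"
      unfolding X F0 by auto
    finally show "?b j * h ^ j * (?F j z - ?F j 0) / h = \<dots>" .
  qed
  also have "\<dots> = - (\<Sum>j=2..Suc L. ?b j * h ^ (j - 1) * polylog (2 - int j) (exp z) + (if j = 2 then h / 24 else 0))
      - (\<Sum>j=2..Suc L. ?b j * xlnx_deriv j (of_nat N))"
    by (simp add: sum_subtractf sum.distrib sum_negf)
  also have "(\<Sum>j=2..Suc L. ?b j * h ^ (j - 1) * polylog (2 - int j) (exp z) + (if j = 2 then h / 24 else 0))
      = (\<Sum>l=1..L. ffun l z / of_nat N ^ l)"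
    by (rule sum.reindex_bij_witness[of _ Suc "\<lambda>j. j - 1"])
       (auto simp: ffun_altdef h_def power_divide add_divide_distrib)
  finally show ?thesis by simp
qed

section \<open>Bounds uniform in z\<close>

lemma compact_sector:
  assumes "c > 0"
  shows "compact {w. cmod w \<le> C \<and> Re w \<le> - c * cmod w}"
proof -
  have "{w. cmod w \<le> C \<and> Re w \<le> - c * cmod w} = cball 0 C \<inter> {w. Re w \<le> - c * cmod w}"
    by auto
  moreover have "closed {w. Re w \<le> - c * cmod w}"
    by (intro closed_Collect_le continuous_intros)
  ultimately show ?thesis by (simp add: compact_Int_closed)
qed

text \<open>The closed sector, vertex 0 included, is a compact subset of \<open>log_dom\<close>, on
  which every derivative is continuous.\<close>

lemma higher_deriv_log_prim_bounded:
  assumes "c > 0"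
  shows "\<exists>B. \<forall>w. cmod w \<le> C \<and> Re w \<le> - c * cmod w \<longrightarrow> cmod ((deriv ^^ j) log_prim w) \<le> B"
proof -
  let ?K = "{w. cmod w \<le> C \<and> Re w \<le> - c * cmod w}"
  have sub: "?K \<subseteq> log_dom"
  proof
    fix w assume w: "w \<in> ?K"
    show "w \<in> log_dom"
    proof (cases "w = 0")
      case False
      hence "c * cmod w > 0" using assms by simp
      thus ?thesis using w by (simp add: log_dom_def)
    qed (simp add: log_dom_def)
  qed
  have "(deriv ^^ j) log_prim holomorphic_on log_dom"
    by (intro holomorphic_higher_deriv holomorphic_log_prim open_log_dom)
  hence "continuous_on ?K ((deriv ^^ j) log_prim)"
    using holomorphic_on_imp_continuous_on continuous_on_subset sub by blast
  hence "bounded ((deriv ^^ j) log_prim ` ?K)"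
    using compact_sector[OF assms] compact_continuous_image compact_imp_bounded by blast
  thus ?thesis by (auto simp: bounded_iff)
qed

lemma ffun_bounded:
  assumes "\<delta> > 0"
  shows "\<exists>B. \<forall>z. cmod z \<le> C \<and> Re z \<le> - \<delta> \<longrightarrow> cmod (ffun l z) \<le> B"
proof -
  let ?K = "cball 0 C \<inter> {z. Re z \<le> - \<delta>}"
  have "continuous_on ?K (\<lambda>z. polylog (2 - int (Suc l)) (exp z))"
  proof (rule continuous_at_imp_continuous_on, rule ballI)
    fix z assume "z \<in> ?K"
    hence "Re z < 0" using assms by auto
    thus "isCont (\<lambda>z. polylog (2 - int (Suc l)) (exp z)) z"
      using DERIV_isCont has_field_derivative_polylog_exp by blast
  qed
  hence "continuous_on ?K (ffun l)"
    unfolding ffun_altdef[abs_def] by (cases "l = 1") (auto intro!: continuous_intros)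
  moreover have "compact ?K"
    by (intro compact_Int_closed compact_cball closed_halfspace_Re_le)
  ultimately have "bounded (ffun l ` ?K)"
    using compact_continuous_image compact_imp_bounded by blast
  then obtain B where "\<forall>x\<in>ffun l ` ?K. cmod x \<le> B" unfolding bounded_iff by blast
  thus ?thesis by (intro exI[of _ B]) auto
qed

text \<open>Euler--Maclaurin with \<open>M = Suc L\<close> along the segment from 0 to z, whose N
  steps each cost a multiple of |h|^(L+2).\<close>

lemma sum_log_quot_expansion:
  fixes L :: nat and \<delta> C :: real
  assumes L: "L \<ge> 1" and \<delta>: "\<delta> > 0" and C: "C > 0"
  shows "\<exists>K. \<forall>N z. N \<ge> 1 \<and> Re z \<le> - \<delta> \<and> cmod z \<le> C \<longrightarrow>
           cmod ((\<Sum>j\<le>Suc L. of_real (bern_coeff j) * (z / of_nat N) ^ j *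
                    ((deriv ^^ j) log_prim z - (deriv ^^ j) log_prim 0)) / (z / of_nat N)
                 - (\<Sum>k<N. log_quot (of_nat k * (z / of_nat N)))) \<le> K / real N ^ L"
proof -
  let ?F = "\<lambda>j. (deriv ^^ j) log_prim"
  let ?b = "\<lambda>j. complex_of_real (bern_coeff j)"
  \<comment> \<open>With this opening, \<open>Re z \<le> - \<delta>\<close> and
    \<open>cmod z \<le> C\<close> put z into the sector; scaling by t in [0, 1] keeps the whole
    segment there.\<close>
  define c where "c = \<delta> / C"
  have c: "c > 0" using \<delta> C by (simp add: c_def)
  obtain B where B: "\<And>w. cmod w \<le> C \<Longrightarrow> Re w \<le> - c * cmod w \<Longrightarrow> cmod (?F (Suc (Suc L)) w) \<le> B"
    using higher_deriv_log_prim_bounded[OF c, of C "Suc (Suc L)"] by blast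
  have B0: "B \<ge> 0" using B[of 0] C order_trans[OF norm_ge_zero] by simp
  define A where "A = (\<Sum>j\<le>Suc L. \<bar>bern_coeff j\<bar>) * B"
  have A0: "A \<ge> 0" unfolding A_def by (intro mult_nonneg_nonneg sum_nonneg B0) auto
  have "cmod ((\<Sum>j\<le>Suc L. ?b j * (z / of_nat N) ^ j * (?F j z - ?F j 0)) / (z / of_nat N)
           - (\<Sum>k<N. log_quot (of_nat k * (z / of_nat N)))) \<le> (A * C ^ Suc L) / real N ^ L"
    if N: "N \<ge> 1" and z: "Re z \<le> - \<delta>" "cmod z \<le> C" for N z
  proof -
    define h where "h = z / of_nat N"
    define X where "X = (\<Sum>j\<le>Suc L. ?b j * h ^ j * (?F j z - ?F j 0))"
    define Y where "Y = (\<Sum>k<N. log_quot (of_nat k * h))"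
    have h: "h \<noteq> 0" "of_nat N * h = z" using z N \<delta> by (auto simp: h_def)
    have seg: "cmod w \<le> C \<and> Re w \<le> - c * cmod w" if w: "w \<in> closed_segment 0 z" for w
    proof -
      obtain t where "0 \<le> t" "t \<le> 1" "w = (1 - t) *\<^sub>R 0 + t *\<^sub>R z"
        using w unfolding in_segment by blast
      hence t: "0 \<le> t" "t \<le> 1" "w = of_real t * z" by (auto simp: scaleR_conv_of_real)
      have "c * cmod z \<le> c * C" using z c by (intro mult_left_mono) auto
      also have "c * C = \<delta>" using C by (simp add: c_def)
      finally have "Re z \<le> - (c * cmod z)" using z by linarith
      hence "t * Re z \<le> t * - (c * cmod z)" using t by (intro mult_left_mono) auto
      moreover have "t * cmod z \<le> 1 * C" using t z by (intro mult_mono) auto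
      ultimately show ?thesis using t by (simp add: norm_mult mult_ac)
    qed
    have dom: "w \<in> log_dom" if "w \<in> closed_segment 0 z" for w
      using seg[OF that] c
      by (cases "w = 0") (auto simp: log_dom_def intro: le_less_trans)
    have "cmod ((\<Sum>j\<le>Suc L. ?b j * h ^ j * (?F j (of_nat N * h) - ?F j 0)) - h * (\<Sum>k<N. ?F 1 (of_nat k * h)))
         \<le> (\<Sum>j\<le>Suc L. \<bar>bern_coeff j\<bar>) * B * real N * cmod h ^ Suc (Suc L)"
    proof (rule euler_maclaurin_segment)
      show "convex (closed_segment 0 z)" by simp
      show "(?F j has_field_derivative ?F (Suc j) u) (at u within closed_segment 0 z)"
        if "u \<in> closed_segment 0 z" for j u
        using has_field_derivative_higher_deriv[OF holomorphic_log_prim open_log_dom dom[OF that]]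
        by (rule has_field_derivative_at_within)
      show "cmod (?F (Suc (Suc L)) u) \<le> B" if "u \<in> closed_segment 0 z" for u
        using seg[OF that] by (intro B) auto
      show "of_nat k * h \<in> closed_segment 0 z" if "k \<le> N" for k
        unfolding in_segment using that N
        by (intro exI[of _ "real k / real N"]) (auto simp: h_def scaleR_conv_of_real)
    qed auto
    also have "(\<Sum>k<N. ?F 1 (of_nat k * h)) = Y"
      unfolding Y_def
    proof (rule sum.cong[OF refl])
      fix k assume "k \<in> {..<N}"
      hence "of_nat k * h \<in> closed_segment 0 z"
        unfolding in_segment using N
        by (intro exI[of _ "real k / real N"]) (auto simp: h_def scaleR_conv_of_real)
      from higher_deriv_log_prim_Suc[OF dom[OF this], of 0]
      show "?F 1 (of_nat k * h) = log_quot (of_nat k * h)" by simp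
    qed
    finally have XY: "cmod (X - h * Y) \<le> A * real N * cmod h ^ Suc (Suc L)"
      by (simp add: X_def A_def h)
    \<comment> \<open>Dividing by h loses one power: N |h|^(L+1) = |z|^(L+1) / N^L.\<close>
    have "cmod (X / h - Y) = cmod (X - h * Y) / cmod h"
      using h by (simp add: field_simps flip: norm_divide)
    also have "\<dots> \<le> A * real N * cmod h ^ Suc (Suc L) / cmod h"
      using XY by (intro divide_right_mono) auto
    also have "\<dots> = A * cmod z ^ Suc L / real N ^ L"
      using h(1) N by (simp add: h_def norm_divide power_divide field_simps)
    also have "\<dots> \<le> A * C ^ Suc L / real N ^ L"
      using z A0 by (intro divide_right_mono mult_left_mono power_mono) auto
    finally show ?thesis by (simp add: X_def Y_def h_def)
  qed
  thus ?thesis by blast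
qed

theorem theorem2p1:
  fixes L :: nat and \<delta> C :: real
  assumes "L \<ge> 1" and "\<delta> > 0" and "C > 0"
  shows "\<exists>K::real. \<forall>N::nat. \<forall>z::complex.
           N \<ge> 1 \<and> Re z \<le> - \<delta> \<and> cmod z \<le> C \<longrightarrow>
           (\<exists>E::complex. cmod E \<le> K / real N ^ L \<and>
              1 / qpoch (exp (z / of_nat N)) N =
                csqrt (- z / (2 * of_real pi * of_nat N * (1 - exp z)))
                * exp (of_nat N * pfun z + (\<Sum>l=1..L-1. ffun l z / of_nat N ^ l) + E))"
proof -
  let ?b = "\<lambda>j. complex_of_real (bern_coeff j)"
  \<comment> \<open>The remainders of the Stirling series and of the sum of \<open>log_quot\<close>,
    both truncated at \<open>j = Suc L\<close>.\<close>
  let ?S1 = "\<lambda>N. of_real (ln (fact N)) - of_real (ln (real N)) - of_real (ln (2 * pi) / 2)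
            - (\<Sum>j\<le>Suc L. ?b j * xlnx_deriv j (of_nat N))"
  let ?S2 = "\<lambda>N z. (\<Sum>j\<le>Suc L. ?b j * (z / of_nat N) ^ j *
                    ((deriv ^^ j) log_prim z - (deriv ^^ j) log_prim 0)) / (z / of_nat N)
                 - (\<Sum>k<N. log_quot (of_nat k * (z / of_nat N)))"
  obtain K1 where K1: "\<And>N. N \<ge> 1 \<Longrightarrow> cmod (?S1 N) \<le> K1 / real N ^ L"
    using stirling_expansion[of "Suc L"] assms(1) by auto
  obtain K2 where K2: "\<And>N z. N \<ge> 1 \<Longrightarrow> Re z \<le> - \<delta> \<Longrightarrow> cmod z \<le> C \<Longrightarrow> cmod (?S2 N z) \<le> K2 / real N ^ L"
    using sum_log_quot_expansion[OF assms] by blast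
  \<comment> \<open>Truncation at \<open>Suc L\<close> yields the terms \<open>ffun l\<close> up to
    \<open>l = L\<close>, one more than claimed; the last is absorbed into the error.\<close>
  obtain K3 where K3: "\<And>z. cmod z \<le> C \<Longrightarrow> Re z \<le> - \<delta> \<Longrightarrow> cmod (ffun L z) \<le> K3"
    using ffun_bounded[OF assms(2)] by blast
  show ?thesis
  proof (rule exI[of _ "K3 + K1 + K2"], intro allI impI)
    fix N :: nat and z :: complex
    assume "N \<ge> 1 \<and> Re z \<le> - \<delta> \<and> cmod z \<le> C"
    hence N: "N \<ge> 1" and z: "Re z \<le> - \<delta>" "cmod z \<le> C" by auto
    have z0: "Re z < 0" using z assms by linarith
    define h where "h = z / of_nat N"
    define e1 where "e1 = ?S1 N"
    define e2 where "e2 = ?S2 N z"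
    define E where "E = ffun L z / of_nat N ^ L - e1 + e2"
    define Sg where "Sg = (\<Sum>j=2..Suc L. ?b j * xlnx_deriv j (of_nat N))"
    define T where "T = (\<Sum>l=1..L-1. ffun l z / of_nat N ^ l)"
    define lq where "lq = log_quot z"
    define Y where "Y = (\<Sum>k<N. log_quot (of_nat k * h))"
    define lN where "lN = complex_of_real (ln (real N))"
    define l2p where "l2p = complex_of_real (ln (2 * pi))"
    have "cmod E \<le> cmod (ffun L z / of_nat N ^ L) + cmod e1 + cmod e2"
      unfolding E_def by (meson add_mono norm_triangle_ineq norm_triangle_ineq4 order_trans order.refl)
    also have "\<dots> \<le> K3 / real N ^ L + K1 / real N ^ L + K2 / real N ^ L"
      using K1[OF N] K2[OF N z] K3[OF z(2,1)] unfolding e1_def e2_def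
      by (intro add_mono) (auto simp: norm_divide norm_power intro!: divide_right_mono)
    finally have "cmod E \<le> (K3 + K1 + K2) / real N ^ L" by (simp add: add_divide_distrib)
    moreover have "1 / qpoch (exp (z / of_nat N)) N =
                csqrt (- z / (2 * of_real pi * of_nat N * (1 - exp z)))
                * exp (of_nat N * pfun z + T + E)"
    proof -
      have S: "(\<Sum>l=1..L. ffun l z / of_nat N ^ l) = T + ffun L z / of_nat N ^ L"
        using assms(1) by (cases L) (auto simp: T_def)
      have LnN: "Ln (of_nat N) = lN" using N by (simp add: lN_def)
      have st: "complex_of_real (ln (fact N)) = lN + l2p / 2 + (of_nat N * lN - of_nat N - lN / 2 + Sg) + e1"
        unfolding e1_def Sg_def sum_atMost_split_2[OF assms(1)]
        by (simp add: bern_coeff_0 bern_coeff_1[simplified] l2p_def LnN del: sum.cl_ivl_Suc)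
           (simp add: lN_def)
      have Lnh: "Ln (- h) = Ln (- z) - lN"
        using Ln_divide_right_half_plane[of "- z" "of_nat N"] z0 N by (simp add: h_def lN_def)
      have Y: "Y = - (of_nat N * pfun z) - of_nat N * Ln (- z) + of_nat N - lq / 2
           - (T + ffun L z / of_nat N ^ L) - Sg - e2"
        using euler_maclaurin_log_quot_terms[OF N z0 assms(1)]
        unfolding e2_def S Y_def Sg_def lq_def h_def by simp
      \<comment> \<open>Passing from k < N to 1 \<le> k \<le> N drops \<open>log_quot 0 = 0\<close>
        and adds \<open>log_quot z\<close>, turning \<open>- lq / 2\<close> into
        \<open>+ lq / 2\<close>.\<close>
      have "(\<Sum>k=1..N. log_quot (of_nat k * h)) = Y + lq"
      proof -
        have "Y + lq = (\<Sum>k\<le>N. log_quot (of_nat k * h))"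
          using N by (simp add: Y_def lq_def h_def flip: lessThan_Suc_atMost)
        also have "{..N} = insert 0 {1..N}" by auto
        finally show ?thesis by (simp add: log_quot_def expm1_quot_def)
      qed
      hence "qpoch (exp h) N = exp (of_real (ln (fact N)) + of_nat N * Ln (- h) + (Y + lq))"
        using qpoch_exp[OF N z0, folded h_def] by (simp only:)
      hence "1 / qpoch (exp (z / of_nat N)) N = exp (- (of_real (ln (fact N)) + of_nat N * Ln (- h) + (Y + lq)))"
        unfolding h_def[symmetric] by (simp only: exp_minus divide_inverse mult_1)
      \<comment> \<open>The terms N ln N, N, N Ln(-z) and \<open>Sg\<close> cancel; the remaining
        half logarithms form the square root.\<close>
      also have "- (of_real (ln (fact N)) + of_nat N * Ln (- h) + (Y + lq))
          = - (lq + lN + l2p) / 2 + (of_nat N * pfun z + T + E)"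
        unfolding st Lnh Y E_def by (simp add: field_simps)
      also have "exp \<dots> = exp (- (lq + lN + l2p) / 2) * exp (of_nat N * pfun z + T + E)"
        by (rule exp_add)
      \<comment> \<open>The principal root is exp of half the principal logarithm, which splits
        without branch correction since -z and 1 - exp z both lie in the right half-plane.\<close>
      also have "exp (- (lq + lN + l2p) / 2) = csqrt (- z / (2 * of_real pi * of_nat N * (1 - exp z)))"
      proof -
        define r where "r = 2 * pi * real N"
        have r: "r > 0" using N by (simp add: r_def)
        have nz: "z \<noteq> 0" "1 - exp z \<noteq> 0" using z0 Re_one_minus_exp_pos[OF z0] by auto
        have "Ln (- z / of_real r / (1 - exp z)) = Ln (- z / of_real r) - Ln (1 - exp z)"
          using z0 r Re_one_minus_exp_pos[OF z0]
          by (intro Ln_divide_right_half_plane) (auto simp: Re_divide_of_real divide_neg_pos)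
        also have "Ln (- z / of_real r) = Ln (- z) - Ln (of_real r)"
          using z0 r by (intro Ln_divide_right_half_plane) auto
        also have "Ln (of_real r) = complex_of_real (ln r)" using r by (rule Ln_of_real)
        also have "ln r = ln (2 * pi) + ln (real N)" using N by (simp add: r_def ln_mult)
        finally have "Ln (- z / of_real r / (1 - exp z)) = - (lq + lN + l2p)"
          by (simp add: lq_def lN_def l2p_def log_quot_half_plane[OF z0])
        moreover have "- z / (2 * of_real pi * of_nat N * (1 - exp z)) = - z / of_real r / (1 - exp z)"
          by (simp add: r_def)
        moreover have "- z / of_real r / (1 - exp z) \<noteq> 0" using nz r by simp
        ultimately show ?thesis using csqrt_exp_Ln by metis
      qed
      finally show ?thesis .
    qed
    ultimately show "\<exists>E::complex. cmod E \<le> (K3 + K1 + K2) / real N ^ L \<and>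
              1 / qpoch (exp (z / of_nat N)) N =
                csqrt (- z / (2 * of_real pi * of_nat N * (1 - exp z)))
                * exp (of_nat N * pfun z + (\<Sum>l=1..L-1. ffun l z / of_nat N ^ l) + E)"
      unfolding T_def by blast
  qed
qed

end
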